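(* Let $p:\Theta\to X$ and $f:X\to Y$ be morphisms in a $*$-preserving a.e. modular (even) subcategory $\mathcal{C}$ of a quantum Markov category, and set $q:=f\circ p$. Then the following conditions are equivalent. (a) A disintegration of $(f,p,q)$ exists in $\mathcal{C}$. (b) $f$ is $p$-a.e. deterministic and a Bayesian inverse of $(f,p,q)$ exists in $\mathcal{C}$. Furthermore, in either of these cases, any disintegration of $(f,p,q)$ is $q$-a.e. equivalent to any Bayesian inverse of $(f,p,q)$. In particular, any two disintegrations of $(f,p,q)$ are $q$-a.e. equivalent.
   Context: A $\mathbb{Z}_2$-monoidal category is a category in which every morphism has a grade in $\mathbb{Z}_2=\{0,1\}$ ($0$ = even, $1$ = odd), identities being even and grades adding under composition, such that for each object $X$ and each grade there is an isomorphism with source $X$ of that grade; together with a tensor product assigning $X\otimes Y$ to objects and $f\otimes f'$ (of the common grade) to pairs of morphisms of equal grade, functorially; a unit object $I$ with a chosen odd involution $*_I$ of $I$; and even natural isomorphisms (associator, symmetry $c_{X,Y}:X\otimes Y\to Y\otimes X$, unitor $I\otimes X\to X$) satisfying the usual axioms of a symmetric monoidal category. Associators and unitors are suppressed. A quantum CD category is a $\mathbb{Z}_2$-monoidal category with, for each object $X$, even morphisms $\Delta_X:X\to X\otimes X$, $!_X:X\to I$ and an odd morphism $*_X:X\to X$ such that: $(!_X\otimes\mathrm{id})\Delta_X=\mathrm{id}_X=(\mathrm{id}\otimes{!_X})\Delta_X$; $(\Delta_X\otimes\mathrm{id})\Delta_X=(\mathrm{id}\otimes\Delta_X)\Delta_X$;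 $c_{X,X}( *_X\otimes*_X)\Delta_X=\Delta_X*_X$; $!_{X\otimes Y}={!_X}\otimes{!_Y}$; $!_I=\mathrm{id}_I$; $\Delta_{X\otimes Y}=(\mathrm{id}_X\otimes c_{X,Y}\otimes\mathrm{id}_Y)(\Delta_X\otimes\Delta_Y)$; $\Delta_I=\mathrm{id}_I$; $*_X*_X=\mathrm{id}_X$; $*_{X\otimes Y}=*_X\otimes*_Y$; $!_X*_X=*_I\,!_X$. It is a quantum Markov category if moreover every even $f:X\to Y$ satisfies $!_Y f={!_X}$ and every odd $f:X\to Y$ satisfies $!_Yf={!_X}*_X$. A morphism $f:X\to Y$ is $*$-preserving if $f*_X=*_Yf$; a subcategory is $*$-preserving (even) if all its morphisms are. In an even $*$-preserving subcategory the left and right versions (mirror images under reversing tensor order) of the following notions are equivalent, so only one version is written. - $h,h':Y\to X$ are $q$-a.e. equivalent if $(h\otimes\mathrm{id}_Y)\Delta_Yq=(h'\otimes\mathrm{id}_Y)\Delta_Yq$. - $f$ is $p$-a.e. deterministic if $(f\otimes f\otimes\mathrm{id}_X)(\Delta_X\otimes\mathrm{id}_X)\Delta_Xp=((\Delta_Yf)\otimes\mathrm{id}_X)\Delta_Xp$. - For $p:\Theta\to X$, $q:\Theta\to Y$, $f:X\to Y$ in $\mathcal{C}$ with $fp=q$: a disintegration of $(f,p,q)$ is a $g:Y\to X$ in $\mathcal{C}$ with $gq=p$ and $fg$ $q$-a.e. equivalent to $\mathrm{id}_Y$; a Bayesian inverse of $(f,p,q)$ is a $g:Y\to X$ in $\mathcal{C}$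 with $(g\otimes\mathrm{id}_Y)\Delta_Yq=(\mathrm{id}_X\otimes f)\Delta_Xp$. - $\mathcal{C}$ is a.e. modular if for all $f:X\to Y$, $g:Y\to X$, $q:\Theta\to Y$ in $\mathcal{C}$ with $((fg)\otimes\mathrm{id}_Y)\Delta_Yq=\Delta_Yq$, one has $(\mathrm{id}_X\otimes f\otimes\mathrm{id}_Y)((\Delta_Xg)\otimes\mathrm{id}_Y)\Delta_Yq=(g\otimes\mathrm{id}_Y\otimes\mathrm{id}_Y)(\Delta_Y\otimes\mathrm{id}_Y)\Delta_Yq$. *)

theory Defs
  imports Main "HOL-Library.Z2"
begin

text \<open>
  Grades live in the two-element field \<open>bit\<close>. Composition is written in
  applicative order, so \<open>g \<cdot> f\<close> is ``\<open>g\<close> after \<open>f\<close>''. The functions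
  in the record are total, but the axioms only constrain them on objects and morphisms of the
  category, on composable pairs, and (for the tensor of morphisms) on pairs of equal grade.
\<close>

record ('o, 'm) z2_monoidal =
  Obj :: "'o set"
  Mor :: "'m set"
  src :: "'m \<Rightarrow> 'o"
  tgt :: "'m \<Rightarrow> 'o"
  grade :: "'m \<Rightarrow> bit"
  mcomp :: "'m \<Rightarrow> 'm \<Rightarrow> 'm"  (infixr \<open>\<cdot>\<index>\<close> 65)
  ident :: "'o \<Rightarrow> 'm"  (\<open>\<one>\<index>\<close>)
  tenO :: "'o \<Rightarrow> 'o \<Rightarrow> 'o"  (infixr \<open>\<odot>\<index>\<close> 75)
  tenM :: "'m \<Rightarrow> 'm \<Rightarrow> 'm"  (infixr \<open>\<otimes>\<index>\<close> 75)
  unit_obj :: 'o  (\<open>\<I>\<index>\<close>)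
  unit_star :: 'm
  associator :: "'o \<Rightarrow> 'o \<Rightarrow> 'o \<Rightarrow> 'm"  (\<open>\<a>\<index>\<close>)
  symmetry :: "'o \<Rightarrow> 'o \<Rightarrow> 'm"  (\<open>\<c>\<index>\<close>)
  unitor :: "'o \<Rightarrow> 'm"  (\<open>\<l>\<index>\<close>)

context
  fixes M :: "('o, 'm, 'e) z2_monoidal_scheme" (structure)
begin

definition hom :: "'o \<Rightarrow> 'o \<Rightarrow> 'm set" where
  "hom X Y = {f \<in> Mor M. src M f = X \<and> tgt M f = Y}"

definition inverses :: "'m \<Rightarrow> 'm \<Rightarrow> bool" where
  "inverses f g \<longleftrightarrow> f \<in> Mor M \<and> g \<in> hom (tgt M f) (src M f) \<and>
     g \<cdot> f = \<one> (src M f) \<and> f \<cdot> g = \<one> (tgt M f)"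

definition isomorphism :: "'m \<Rightarrow> bool" where
  "isomorphism f \<longleftrightarrow> (\<exists>g. inverses f g)"

definition inv_mor :: "'m \<Rightarrow> 'm" where
  "inv_mor f = (THE g. inverses f g)"

text \<open>The functor from the one-object category \<open>\<int>\<^sub>2\<close> that picks out the unit object.\<close>

definition unit_mor :: "bit \<Rightarrow> 'm" where
  "unit_mor d = (if d = 0 then \<one> \<I> else unit_star M)"

definition right_unitor :: "'o \<Rightarrow> 'm" where
  "right_unitor X = \<l> X \<cdot> \<c> X \<I>"

text \<open>The canonical morphism \<open>(W \<otimes> X) \<otimes> (Y \<otimes> Z) \<rightarrow> (W \<otimes> Y) \<otimes> (X \<otimes> Z)\<close> swapping the
  two middle factors: \<open>id \<otimes> c \<otimes> id\<close> with the associators written out.\<close>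

definition middle_swap :: "'o \<Rightarrow> 'o \<Rightarrow> 'o \<Rightarrow> 'o \<Rightarrow> 'm" where
  "middle_swap W X Y Z =
     inv_mor (\<a> W Y (X \<odot> Z)) \<cdot>
     (\<one> W \<otimes> (\<a> Y X Z \<cdot> (\<c> X Y \<otimes> \<one> Z) \<cdot> inv_mor (\<a> X Y Z))) \<cdot>
     \<a> W X (Y \<odot> Z)"

end

locale z2_graded_category =
  fixes M :: "('o, 'm, 'e) z2_monoidal_scheme" (structure)
  assumes src_in_Obj: "f \<in> Mor M \<Longrightarrow> src M f \<in> Obj M"
    and tgt_in_Obj: "f \<in> Mor M \<Longrightarrow> tgt M f \<in> Obj M"
    and ident_hom: "X \<in> Obj M \<Longrightarrow> \<one> X \<in> hom M X X"
    and comp_hom: "\<lbrakk>f \<in> hom M X Y; g \<in> hom M Y Z\<rbrakk> \<Longrightarrow> g \<cdot> f \<in> hom M X Z"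
    and comp_ident_left: "f \<in> hom M X Y \<Longrightarrow> \<one> Y \<cdot> f = f"
    and comp_ident_right: "f \<in> hom M X Y \<Longrightarrow> f \<cdot> \<one> X = f"
    and comp_assoc: "\<lbrakk>f \<in> hom M W X; g \<in> hom M X Y; h \<in> hom M Y Z\<rbrakk>
      \<Longrightarrow> (h \<cdot> g) \<cdot> f = h \<cdot> (g \<cdot> f)"
    and grade_ident: "X \<in> Obj M \<Longrightarrow> grade M (\<one> X) = 0"
    and grade_comp: "\<lbrakk>f \<in> hom M X Y; g \<in> hom M Y Z\<rbrakk>
      \<Longrightarrow> grade M (g \<cdot> f) = grade M g + grade M f"
    and iso_of_each_grade: "X \<in> Obj M
      \<Longrightarrow> \<exists>f. isomorphism M f \<and> src M f = X \<and> grade M f = d"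

locale z2_monoidal_category = z2_graded_category +
  assumes tenO_in_Obj: "\<lbrakk>X \<in> Obj M; Y \<in> Obj M\<rbrakk> \<Longrightarrow> X \<odot> Y \<in> Obj M"
    and tenM_hom: "\<lbrakk>f \<in> hom M X Y; f' \<in> hom M X' Y'; grade M f = grade M f'\<rbrakk>
      \<Longrightarrow> f \<otimes> f' \<in> hom M (X \<odot> X') (Y \<odot> Y')"
    and grade_tenM: "\<lbrakk>f \<in> Mor M; f' \<in> Mor M; grade M f = grade M f'\<rbrakk>
      \<Longrightarrow> grade M (f \<otimes> f') = grade M f"
    and tenM_ident: "\<lbrakk>X \<in> Obj M; Y \<in> Obj M\<rbrakk> \<Longrightarrow> \<one> X \<otimes> \<one> Y = \<one> (X \<odot> Y)"
    and tenM_comp: "\<lbrakk>f \<in> hom M X Y; g \<in> hom M Y Z; f' \<in> hom M X' Y'; g' \<in> hom M Y' Z';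
        grade M f = grade M f'; grade M g = grade M g'\<rbrakk>
      \<Longrightarrow> (g \<cdot> f) \<otimes> (g' \<cdot> f') = (g \<otimes> g') \<cdot> (f \<otimes> f')"
    and unit_in_Obj: "\<I> \<in> Obj M"
    and unit_star_hom: "unit_star M \<in> hom M \<I> \<I>"
    and unit_star_odd: "grade M (unit_star M) = 1"
    and unit_star_involution: "unit_star M \<cdot> unit_star M = \<one> \<I>"
    and associator_hom: "\<lbrakk>X \<in> Obj M; Y \<in> Obj M; Z \<in> Obj M\<rbrakk>
      \<Longrightarrow> \<a> X Y Z \<in> hom M ((X \<odot> Y) \<odot> Z) (X \<odot> (Y \<odot> Z))"
    and associator_even: "\<lbrakk>X \<in> Obj M; Y \<in> Obj M; Z \<in> Obj M\<rbrakk> \<Longrightarrow> grade M (\<a> X Y Z) = 0"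
    and associator_iso: "\<lbrakk>X \<in> Obj M; Y \<in> Obj M; Z \<in> Obj M\<rbrakk> \<Longrightarrow> isomorphism M (\<a> X Y Z)"
    and associator_natural: "\<lbrakk>f \<in> hom M X X'; g \<in> hom M Y Y'; h \<in> hom M Z Z';
        grade M f = grade M g; grade M g = grade M h\<rbrakk>
      \<Longrightarrow> \<a> X' Y' Z' \<cdot> ((f \<otimes> g) \<otimes> h) = (f \<otimes> (g \<otimes> h)) \<cdot> \<a> X Y Z"
    and symmetry_hom: "\<lbrakk>X \<in> Obj M; Y \<in> Obj M\<rbrakk> \<Longrightarrow> \<c> X Y \<in> hom M (X \<odot> Y) (Y \<odot> X)"
    and symmetry_even: "\<lbrakk>X \<in> Obj M; Y \<in> Obj M\<rbrakk> \<Longrightarrow> grade M (\<c> X Y) = 0"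
    and symmetry_natural: "\<lbrakk>f \<in> hom M X X'; g \<in> hom M Y Y'; grade M f = grade M g\<rbrakk>
      \<Longrightarrow> \<c> X' Y' \<cdot> (f \<otimes> g) = (g \<otimes> f) \<cdot> \<c> X Y"
    and unitor_hom: "X \<in> Obj M \<Longrightarrow> \<l> X \<in> hom M (\<I> \<odot> X) X"
    and unitor_even: "X \<in> Obj M \<Longrightarrow> grade M (\<l> X) = 0"
    and unitor_iso: "X \<in> Obj M \<Longrightarrow> isomorphism M (\<l> X)"
    and unitor_natural: "f \<in> hom M X Y
      \<Longrightarrow> \<l> Y \<cdot> (unit_mor M (grade M f) \<otimes> f) = f \<cdot> \<l> X"
    and pentagon: "\<lbrakk>W \<in> Obj M; X \<in> Obj M; Y \<in> Obj M; Z \<in> Obj M\<rbrakk>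
      \<Longrightarrow> \<a> W X (Y \<odot> Z) \<cdot> \<a> (W \<odot> X) Y Z
        = (\<one> W \<otimes> \<a> X Y Z) \<cdot> \<a> W (X \<odot> Y) Z \<cdot> (\<a> W X Y \<otimes> \<one> Z)"
    and triangle: "\<lbrakk>X \<in> Obj M; Y \<in> Obj M\<rbrakk>
      \<Longrightarrow> (\<one> X \<otimes> \<l> Y) \<cdot> \<a> X \<I> Y = right_unitor M X \<otimes> \<one> Y"
    and hexagon: "\<lbrakk>X \<in> Obj M; Y \<in> Obj M; Z \<in> Obj M\<rbrakk>
      \<Longrightarrow> \<a> Y Z X \<cdot> \<c> X (Y \<odot> Z) \<cdot> \<a> X Y Z
        = (\<one> Y \<otimes> \<c> X Z) \<cdot> \<a> Y X Z \<cdot> (\<c> X Y \<otimes> \<one> Z)"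
    and symmetry_symmetry: "\<lbrakk>X \<in> Obj M; Y \<in> Obj M\<rbrakk> \<Longrightarrow> \<c> Y X \<cdot> \<c> X Y = \<one> (X \<odot> Y)"

record ('o, 'm) quantum_cd = "('o, 'm) z2_monoidal" +
  copy :: "'o \<Rightarrow> 'm"  (\<open>\<Delta>\<index>\<close>)
  discard :: "'o \<Rightarrow> 'm"  (\<open>\<top>\<index>\<close>)
  star :: "'o \<Rightarrow> 'm"  (\<open>\<star>\<index>\<close>)

text \<open>
  \<open>\<top> X\<close> is the discarding map \<open>!\<^sub>X\<close>. The unit object carries two
  odd endomorphisms, \<open>unit_star\<close> and \<open>\<star> \<I>\<close>; they coincide by
  \<open>discard_star\<close> at the unit object together with \<open>discard_unit\<close>.
\<close>

locale quantum_cd_category =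
  z2_monoidal_category M for M :: "('o, 'm, 'e) quantum_cd_scheme" (structure) +
  assumes copy_hom: "X \<in> Obj M \<Longrightarrow> \<Delta> X \<in> hom M X (X \<odot> X)"
    and copy_even: "X \<in> Obj M \<Longrightarrow> grade M (\<Delta> X) = 0"
    and discard_hom: "X \<in> Obj M \<Longrightarrow> \<top> X \<in> hom M X \<I>"
    and discard_even: "X \<in> Obj M \<Longrightarrow> grade M (\<top> X) = 0"
    and star_hom: "X \<in> Obj M \<Longrightarrow> \<star> X \<in> hom M X X"
    and star_odd: "X \<in> Obj M \<Longrightarrow> grade M (\<star> X) = 1"
    and counit_left: "X \<in> Obj M \<Longrightarrow> \<l> X \<cdot> (\<top> X \<otimes> \<one> X) \<cdot> \<Delta> X = \<one> X"
    and counit_right: "X \<in> Obj M \<Longrightarrow> right_unitor M X \<cdot> (\<one> X \<otimes> \<top> X) \<cdot> \<Delta> X = \<one> X"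
    and coassoc: "X \<in> Obj M
      \<Longrightarrow> \<a> X X X \<cdot> (\<Delta> X \<otimes> \<one> X) \<cdot> \<Delta> X = (\<one> X \<otimes> \<Delta> X) \<cdot> \<Delta> X"
    and copy_star: "X \<in> Obj M \<Longrightarrow> \<c> X X \<cdot> (\<star> X \<otimes> \<star> X) \<cdot> \<Delta> X = \<Delta> X \<cdot> \<star> X"
    and discard_tensor: "\<lbrakk>X \<in> Obj M; Y \<in> Obj M\<rbrakk> \<Longrightarrow> \<top> (X \<odot> Y) = \<l> \<I> \<cdot> (\<top> X \<otimes> \<top> Y)"
    and discard_unit: "\<top> \<I> = \<one> \<I>"
    and copy_tensor: "\<lbrakk>X \<in> Obj M; Y \<in> Obj M\<rbrakk>
      \<Longrightarrow> \<Delta> (X \<odot> Y) = middle_swap M X X Y Y \<cdot> (\<Delta> X \<otimes> \<Delta> Y)"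
    and copy_unit: "\<l> \<I> \<cdot> \<Delta> \<I> = \<one> \<I>"
    and star_star: "X \<in> Obj M \<Longrightarrow> \<star> X \<cdot> \<star> X = \<one> X"
    and star_tensor: "\<lbrakk>X \<in> Obj M; Y \<in> Obj M\<rbrakk> \<Longrightarrow> \<star> (X \<odot> Y) = \<star> X \<otimes> \<star> Y"
    and discard_star: "X \<in> Obj M \<Longrightarrow> \<top> X \<cdot> \<star> X = unit_star M \<cdot> \<top> X"

locale quantum_markov_category = quantum_cd_category +
  assumes discard_even_mor: "\<lbrakk>f \<in> hom M X Y; grade M f = 0\<rbrakk> \<Longrightarrow> \<top> Y \<cdot> f = \<top> X"
    and discard_odd_mor: "\<lbrakk>f \<in> hom M X Y; grade M f = 1\<rbrakk> \<Longrightarrow> \<top> Y \<cdot> f = \<top> X \<cdot> \<star> X"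

context
  fixes M :: "('o, 'm, 'e) quantum_cd_scheme" (structure)
begin

text \<open>A subcategory is given by its set \<open>A\<close> of objects and its set \<open>C\<close> of
  morphisms. It is neither assumed to be full, nor closed under tensor products, nor to contain any
  of the structure maps \<open>\<Delta>\<close>, \<open>\<top>\<close>, \<open>\<star>\<close>.\<close>

definition subcategory :: "'o set \<Rightarrow> 'm set \<Rightarrow> bool" where
  "subcategory A C \<longleftrightarrow> A \<subseteq> Obj M \<and> C \<subseteq> Mor M \<and>
     (\<forall>f\<in>C. src M f \<in> A \<and> tgt M f \<in> A) \<and>
     (\<forall>X\<in>A. \<one> X \<in> C) \<and>
     (\<forall>f\<in>C. \<forall>g\<in>C. src M g = tgt M f \<longrightarrow> g \<cdot> f \<in> C)"

definition even_mors :: "'m set \<Rightarrow> bool" where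
  "even_mors C \<longleftrightarrow> (\<forall>f\<in>C. grade M f = 0)"

definition star_preserving :: "'m \<Rightarrow> bool" where
  "star_preserving f \<longleftrightarrow> f \<cdot> \<star> (src M f) = \<star> (tgt M f) \<cdot> f"

definition star_preserving_mors :: "'m set \<Rightarrow> bool" where
  "star_preserving_mors C \<longleftrightarrow> (\<forall>f\<in>C. star_preserving f)"

text \<open>In the following equations all triple tensor products are bracketed to the left, which makes
  every composite well-typed without associators.\<close>

definition ae_equiv :: "'m \<Rightarrow> 'm \<Rightarrow> 'm \<Rightarrow> bool" where
  "ae_equiv q h h' \<longleftrightarrow> (let Y = tgt M q in
     (h \<otimes> \<one> Y) \<cdot> \<Delta> Y \<cdot> q = (h' \<otimes> \<one> Y) \<cdot> \<Delta> Y \<cdot> q)"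

definition ae_deterministic :: "'m \<Rightarrow> 'm \<Rightarrow> bool" where
  "ae_deterministic p f \<longleftrightarrow> (let X = src M f; Y = tgt M f in
     ((f \<otimes> f) \<otimes> \<one> X) \<cdot> (\<Delta> X \<otimes> \<one> X) \<cdot> \<Delta> X \<cdot> p
       = ((\<Delta> Y \<cdot> f) \<otimes> \<one> X) \<cdot> \<Delta> X \<cdot> p)"

definition disintegration :: "'m set \<Rightarrow> 'm \<Rightarrow> 'm \<Rightarrow> 'm \<Rightarrow> 'm \<Rightarrow> bool" where
  "disintegration C f p q g \<longleftrightarrow> (let X = src M f; Y = tgt M f in
     g \<in> C \<and> g \<in> hom M Y X \<and> g \<cdot> q = p \<and> ae_equiv q (f \<cdot> g) (\<one> Y))"

definition bayesian_inverse :: "'m set \<Rightarrow> 'm \<Rightarrow> 'm \<Rightarrow> 'm \<Rightarrow> 'm \<Rightarrow> bool" where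
  "bayesian_inverse C f p q g \<longleftrightarrow> (let X = src M f; Y = tgt M f in
     g \<in> C \<and> g \<in> hom M Y X \<and>
     (g \<otimes> \<one> Y) \<cdot> \<Delta> Y \<cdot> q = (\<one> X \<otimes> f) \<cdot> \<Delta> X \<cdot> p)"

definition ae_modular :: "'m set \<Rightarrow> bool" where
  "ae_modular C \<longleftrightarrow> (\<forall>\<Theta> X Y f g q.
     f \<in> C \<longrightarrow> g \<in> C \<longrightarrow> q \<in> C \<longrightarrow>
     f \<in> hom M X Y \<longrightarrow> g \<in> hom M Y X \<longrightarrow> q \<in> hom M \<Theta> Y \<longrightarrow>
     ((f \<cdot> g) \<otimes> \<one> Y) \<cdot> \<Delta> Y \<cdot> q = \<Delta> Y \<cdot> q \<longrightarrow>
     ((\<one> X \<otimes> f) \<otimes> \<one> Y) \<cdot> ((\<Delta> X \<cdot> g) \<otimes> \<one> Y) \<cdot> \<Delta> Y \<cdot> q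
       = ((g \<otimes> \<one> Y) \<otimes> \<one> Y) \<cdot> (\<Delta> Y \<otimes> \<one> Y) \<cdot> \<Delta> Y \<cdot> q)"

end

end

theory Submission
  imports Defs
begin

text \<open>
  Discarding the third factor in the a.e. modularity equation shows that a disintegration is a
  Bayesian inverse, and any two Bayesian inverses are a.e. equivalent because the right-hand side
  of their defining equation does not mention them. Conversely, if \<open>g\<close> is a Bayesian inverse, then
  \<open>(f g \<otimes> id) \<Delta> q = (f \<otimes> f) \<Delta> p\<close>, and this is \<open>\<Delta> q\<close> by discarding the third factor in the
  equation of a.e. determinism. That a disintegration makes \<open>f\<close> a.e. deterministic follows from
  coassociativity and the mirror images of the Bayes and modularity equations; mirror images are
  obtained by composing with \<open>\<c> \<cdot> (\<star> \<otimes> \<star>)\<close>.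
\<close>

section \<open>Typing, associativity and cancellation for graded morphisms\<close>

context z2_graded_category
begin

lemma hom_iff: "f \<in> hom M X Y \<longleftrightarrow> f \<in> Mor M \<and> src M f = X \<and> tgt M f = Y"
  by (simp add: hom_def)

text \<open>Typing through \<open>src\<close>, \<open>tgt\<close> and \<open>grade\<close> instead
  of \<open>hom\<close> lets the simplifier compute types bottom-up and so discharge the premises of
  the conditional rewrite rules.\<close>

lemma comp_type [simp]:
  assumes "f \<in> Mor M" "g \<in> Mor M" "tgt M f = src M g"
  shows "g \<cdot> f \<in> Mor M" "src M (g \<cdot> f) = src M f" "tgt M (g \<cdot> f) = tgt M g"
    "grade M (g \<cdot> f) = grade M g + grade M f"
  using comp_hom [of f "src M f" "src M g" g "tgt M g"]
    grade_comp [of f "src M f" "src M g" g "tgt M g"] assms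
  by (auto simp: hom_iff)

lemma ident_type [simp]:
  assumes "X \<in> Obj M"
  shows "\<one> X \<in> Mor M" "src M (\<one> X) = X" "tgt M (\<one> X) = X" "grade M (\<one> X) = 0"
  using ident_hom [OF assms] grade_ident [OF assms] by (auto simp: hom_iff)

lemma src_tgt_Obj [simp]: "f \<in> Mor M \<Longrightarrow> src M f \<in> Obj M" "f \<in> Mor M \<Longrightarrow> tgt M f \<in> Obj M"
  by (fact src_in_Obj tgt_in_Obj)+

lemma comp_ident [simp]:
  "f \<in> Mor M \<Longrightarrow> tgt M f = Y \<Longrightarrow> \<one> Y \<cdot> f = f"
  "f \<in> Mor M \<Longrightarrow> src M f = X \<Longrightarrow> f \<cdot> \<one> X = f"
  by (auto intro: comp_ident_left comp_ident_right simp: hom_iff)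

lemma assoc_right [simp]:
  "\<lbrakk>f \<in> Mor M; g \<in> Mor M; h \<in> Mor M; tgt M f = src M g; tgt M g = src M h\<rbrakk>
    \<Longrightarrow> (h \<cdot> g) \<cdot> f = h \<cdot> g \<cdot> f"
  by (rule comp_assoc) (auto simp: hom_iff)

text \<open>Composites are normalised to right-nested form, in which \<open>h \<cdot> g\<close> is
  no subterm of \<open>h \<cdot> g \<cdot> f\<close>; this carries an equation of two-fold
  composites over to that form.\<close>

lemma comp_eq_slide:
  assumes "h \<cdot> g = h' \<cdot> g'" "f \<in> Mor M" "g \<in> Mor M" "h \<in> Mor M" "g' \<in> Mor M" "h' \<in> Mor M"
    "tgt M f = src M g" "tgt M g = src M h" "tgt M f = src M g'" "tgt M g' = src M h'"
  shows "h \<cdot> g \<cdot> f = h' \<cdot> g' \<cdot> f"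
  using assms assoc_right [of f g h] assoc_right [of f g' h'] by metis

lemma isomorphism_cancel_left:
  assumes "isomorphism M a" "f \<in> Mor M" "g \<in> Mor M" "tgt M f = src M a" "tgt M g = src M a"
    "a \<cdot> f = a \<cdot> g"
  shows "f = g"
proof -
  obtain b where a: "a \<in> Mor M" and b: "b \<in> hom M (tgt M a) (src M a)"
    and ba: "b \<cdot> a = \<one> (src M a)"
    using assms(1) unfolding isomorphism_def inverses_def by blast
  have "b \<cdot> a \<cdot> f = b \<cdot> a \<cdot> g"
    using assms(6) by simp
  then have "(b \<cdot> a) \<cdot> f = (b \<cdot> a) \<cdot> g"
    using a b assms by (simp add: hom_iff)
  then show ?thesis
    using ba assms by simp
qed

end

section \<open>Calculus of tensor products, symmetry and unitors\<close>

context z2_monoidal_category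
begin

declare tenO_in_Obj [simp] unit_in_Obj [simp]

lemma tenM_type [simp]:
  assumes "f \<in> Mor M" "g \<in> Mor M" "grade M f = grade M g"
  shows "f \<otimes> g \<in> Mor M" "src M (f \<otimes> g) = src M f \<odot> src M g"
    "tgt M (f \<otimes> g) = tgt M f \<odot> tgt M g" "grade M (f \<otimes> g) = grade M g"
  using tenM_hom [of f "src M f" "tgt M f" g "src M g" "tgt M g"] grade_tenM [of f g] assms
  by (auto simp: hom_iff)

lemma symmetry_type [simp]:
  assumes "X \<in> Obj M" "Y \<in> Obj M"
  shows "\<c> X Y \<in> Mor M" "src M (\<c> X Y) = X \<odot> Y" "tgt M (\<c> X Y) = Y \<odot> X" "grade M (\<c> X Y) = 0"
  using symmetry_hom [OF assms] symmetry_even [OF assms] by (auto simp: hom_iff)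

lemma unitor_type [simp]:
  assumes "X \<in> Obj M"
  shows "\<l> X \<in> Mor M" "src M (\<l> X) = \<I> \<odot> X" "tgt M (\<l> X) = X" "grade M (\<l> X) = 0"
  using unitor_hom [OF assms] unitor_even [OF assms] by (auto simp: hom_iff)

lemma associator_type [simp]:
  assumes "X \<in> Obj M" "Y \<in> Obj M" "Z \<in> Obj M"
  shows "\<a> X Y Z \<in> Mor M" "src M (\<a> X Y Z) = (X \<odot> Y) \<odot> Z" "tgt M (\<a> X Y Z) = X \<odot> (Y \<odot> Z)"
    "grade M (\<a> X Y Z) = 0"
  using associator_hom [OF assms] associator_even [OF assms] by (auto simp: hom_iff)

lemma tenM_ident_simp [simp]: "\<lbrakk>X \<in> Obj M; Y \<in> Obj M\<rbrakk> \<Longrightarrow> \<one> X \<otimes> \<one> Y = \<one> (X \<odot> Y)"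
  by (fact tenM_ident)

text \<open>Oriented towards a single tensor, so that successive layers of tensors merge. Equal
  grades are what makes both sides meaningful.\<close>

lemma interchange [simp]:
  assumes "f \<in> Mor M" "g \<in> Mor M" "f' \<in> Mor M" "g' \<in> Mor M" "tgt M f = src M g"
    "tgt M f' = src M g'" "grade M f = grade M f'" "grade M g = grade M g'"
  shows "(g \<otimes> g') \<cdot> (f \<otimes> f') = (g \<cdot> f) \<otimes> (g' \<cdot> f')"
  using tenM_comp [of f "src M f" "src M g" g "tgt M g" f' "src M f'" "src M g'" g' "tgt M g'"]
    assms by (simp add: hom_iff)

lemma interchange_assoc [simp]:
  assumes "f \<in> Mor M" "g \<in> Mor M" "f' \<in> Mor M" "g' \<in> Mor M" "tgt M f = src M g"
    "tgt M f' = src M g'" "grade M f = grade M f'" "grade M g = grade M g'"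
    and "k \<in> Mor M" "tgt M k = src M f \<odot> src M f'"
  shows "(g \<otimes> g') \<cdot> (f \<otimes> f') \<cdot> k = ((g \<cdot> f) \<otimes> (g' \<cdot> f')) \<cdot> k"
  using assms by (simp flip: interchange)

lemma symmetry_slide:
  assumes "f \<in> Mor M" "g \<in> Mor M" "grade M f = grade M g" "tgt M f = X" "tgt M g = Y"
    and "k \<in> Mor M" "tgt M k = src M f \<odot> src M g"
  shows "\<c> X Y \<cdot> (f \<otimes> g) \<cdot> k = (g \<otimes> f) \<cdot> \<c> (src M f) (src M g) \<cdot> k"
  by (rule comp_eq_slide, rule symmetry_natural) (use assms in \<open>auto simp: hom_iff\<close>)

lemma associator_slide:
  assumes "f \<in> Mor M" "g \<in> Mor M" "h \<in> Mor M" "grade M f = grade M g" "grade M g = grade M h"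
    "tgt M f = X" "tgt M g = Y" "tgt M h = Z"
    and "k \<in> Mor M" "tgt M k = (src M f \<odot> src M g) \<odot> src M h"
  shows "\<a> X Y Z \<cdot> ((f \<otimes> g) \<otimes> h) \<cdot> k
    = (f \<otimes> (g \<otimes> h)) \<cdot> \<a> (src M f) (src M g) (src M h) \<cdot> k"
  by (rule comp_eq_slide, rule associator_natural) (use assms in \<open>auto simp: hom_iff\<close>)

text \<open>The right unitor is the left unitor after a symmetry, so both naturalities combine;
  evenness of \<open>f\<close> makes the unit factor an identity instead of
  \<open>unit_star\<close>.\<close>

lemma right_unitor_natural:
  assumes "f \<in> hom M X Y" "grade M f = 0"
  shows "right_unitor M Y \<cdot> (f \<otimes> \<one> \<I>) = f \<cdot> right_unitor M X"
proof -
  have f: "f \<in> Mor M" "src M f = X" "tgt M f = Y" "X \<in> Obj M" "Y \<in> Obj M"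
    using assms by (auto simp: hom_iff)
  have c: "\<c> Y \<I> \<cdot> (f \<otimes> \<one> \<I>) = (\<one> \<I> \<otimes> f) \<cdot> \<c> X \<I>"
    using assms f by (intro symmetry_natural) (auto simp: hom_iff)
  have l: "\<l> Y \<cdot> (\<one> \<I> \<otimes> f) = f \<cdot> \<l> X"
    using unitor_natural [OF assms(1)] assms(2) by (simp add: unit_mor_def)
  have "right_unitor M Y \<cdot> (f \<otimes> \<one> \<I>) = (\<l> Y \<cdot> (\<one> \<I> \<otimes> f)) \<cdot> \<c> X \<I>"
    using f assms(2) by (simp add: right_unitor_def c)
  also have "\<dots> = f \<cdot> right_unitor M X"
    using f assms(2) by (simp add: l right_unitor_def)
  finally show ?thesis .
qed

lemma right_unitor_type [simp]:
  assumes "X \<in> Obj M"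
  shows "right_unitor M X \<in> Mor M" "src M (right_unitor M X) = X \<odot> \<I>"
    "tgt M (right_unitor M X) = X" "grade M (right_unitor M X) = 0"
  using assms by (simp_all add: right_unitor_def)

end

section \<open>Reversal of tensor order by symmetry and star\<close>

context quantum_cd_category
begin

lemma copy_type [simp]:
  assumes "X \<in> Obj M"
  shows "\<Delta> X \<in> Mor M" "src M (\<Delta> X) = X" "tgt M (\<Delta> X) = X \<odot> X" "grade M (\<Delta> X) = 0"
  using copy_hom [OF assms] copy_even [OF assms] by (auto simp: hom_iff)

lemma discard_type [simp]:
  assumes "X \<in> Obj M"
  shows "\<top> X \<in> Mor M" "src M (\<top> X) = X" "tgt M (\<top> X) = \<I>" "grade M (\<top> X) = 0"
  using discard_hom [OF assms] discard_even [OF assms] by (auto simp: hom_iff)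

lemma star_type [simp]:
  assumes "X \<in> Obj M"
  shows "\<star> X \<in> Mor M" "src M (\<star> X) = X" "tgt M (\<star> X) = X" "grade M (\<star> X) = 1"
  using star_hom [OF assms] star_odd [OF assms] by (auto simp: hom_iff)

declare star_star [simp]

lemma star_star_assoc [simp]:
  "f \<in> Mor M \<Longrightarrow> tgt M f = X \<Longrightarrow> \<star> X \<cdot> \<star> X \<cdot> f = f"
  using assoc_right [of f "\<star> X" "\<star> X"] src_tgt_Obj [of f] star_type comp_ident star_star
  by metis

lemma coassoc_slide:
  assumes "k \<in> Mor M" "tgt M k = X"
  shows "\<a> X X X \<cdot> (\<Delta> X \<otimes> \<one> X) \<cdot> \<Delta> X \<cdot> k = (\<one> X \<otimes> \<Delta> X) \<cdot> \<Delta> X \<cdot> k"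
proof -
  have X: "X \<in> Obj M"
    using assms by auto
  have "(\<a> X X X \<cdot> (\<Delta> X \<otimes> \<one> X) \<cdot> \<Delta> X) \<cdot> k = ((\<one> X \<otimes> \<Delta> X) \<cdot> \<Delta> X) \<cdot> k"
    using coassoc [OF X] by simp
  then show ?thesis
    using X assms by simp
qed

text \<open>The axiom \<open>copy_star\<close> solved for the swapped copy, using that
  \<open>\<star> X \<otimes> \<star> X\<close> is an involution.\<close>

lemma symmetry_copy:
  assumes "X \<in> Obj M"
  shows "\<c> X X \<cdot> \<Delta> X = (\<star> X \<otimes> \<star> X) \<cdot> \<Delta> X \<cdot> \<star> X"
proof -
  have "(\<star> X \<otimes> \<star> X) \<cdot> \<Delta> X \<cdot> \<star> X = (\<star> X \<otimes> \<star> X) \<cdot> \<c> X X \<cdot> (\<star> X \<otimes> \<star> X) \<cdot> \<Delta> X"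
    using copy_star [OF assms] by simp
  also have "\<dots> = \<c> X X \<cdot> (\<star> X \<otimes> \<star> X) \<cdot> (\<star> X \<otimes> \<star> X) \<cdot> \<Delta> X"
    using assms by (subst symmetry_slide) simp_all
  also have "\<dots> = \<c> X X \<cdot> \<Delta> X"
    using assms by simp
  finally show ?thesis by simp
qed

text \<open>Conjugation by the star involutions. It fixes star-preserving morphisms but sends
  \<open>\<Delta> X\<close> to \<open>\<c> X X \<cdot> \<Delta> X\<close>, so it has to be tracked
  for composites containing a copy.\<close>

definition conj_star where
  "conj_star h = \<star> (tgt M h) \<cdot> h \<cdot> \<star> (src M h)"

lemma conj_star_type [simp]:
  assumes "h \<in> Mor M"
  shows "conj_star h \<in> Mor M" "src M (conj_star h) = src M h" "tgt M (conj_star h) = tgt M h"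
    "grade M (conj_star h) = grade M h"
  using assms by (simp_all add: conj_star_def)

lemma conj_star_preserving [simp]:
  "h \<in> Mor M \<Longrightarrow> star_preserving M h \<Longrightarrow> conj_star h = h"
  by (simp add: conj_star_def star_preserving_def)

lemma star_preserving_ident [simp]: "X \<in> Obj M \<Longrightarrow> star_preserving M (\<one> X)"
  by (simp add: star_preserving_def)

text \<open>The star splits over the tensor, the symmetry exchanges the two factors, and
  \<open>symmetry_copy\<close> puts stars on the other side of \<open>h\<close> and
  \<open>k\<close>. The star left over passes through \<open>q\<close>, which is star-preserving;
  \<open>h\<close> and \<open>k\<close> may be arbitrary even morphisms.\<close>

lemma mirror:
  assumes "q \<in> hom M W Y" "grade M q = 0" "star_preserving M q"
    and "h \<in> hom M Y Z" "grade M h = 0" "k \<in> hom M Y Z'" "grade M k = 0"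
  shows "\<c> Z Z' \<cdot> \<star> (Z \<odot> Z') \<cdot> (h \<otimes> k) \<cdot> \<Delta> Y \<cdot> q
    = (conj_star k \<otimes> conj_star h) \<cdot> \<Delta> Y \<cdot> q \<cdot> \<star> W"
proof -
  have q: "q \<in> Mor M" "src M q = W" "tgt M q = Y" "q \<cdot> \<star> W = \<star> Y \<cdot> q"
    using assms by (auto simp: hom_iff star_preserving_def)
  have h: "h \<in> Mor M" "src M h = Y" "tgt M h = Z"
    and k: "k \<in> Mor M" "src M k = Y" "tgt M k = Z'"
    using assms by (auto simp: hom_iff)
  have obj: "Y \<in> Obj M" "Z \<in> Obj M" "Z' \<in> Obj M" "W \<in> Obj M"
    using h k q by auto
  note simps = q h k obj assms(2,5,7)
  have "\<c> Z Z' \<cdot> \<star> (Z \<odot> Z') \<cdot> (h \<otimes> k) \<cdot> \<Delta> Y \<cdot> q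
      = \<c> Z Z' \<cdot> ((\<star> Z \<cdot> h) \<otimes> (\<star> Z' \<cdot> k)) \<cdot> \<Delta> Y \<cdot> q"
    using simps by (simp add: star_tensor)
  also have "\<dots> = ((\<star> Z' \<cdot> k) \<otimes> (\<star> Z \<cdot> h)) \<cdot> (\<c> Y Y \<cdot> \<Delta> Y) \<cdot> q"
    using simps by (subst symmetry_slide) simp_all
  also have "\<dots> = (conj_star k \<otimes> conj_star h) \<cdot> \<Delta> Y \<cdot> q \<cdot> \<star> W"
    using simps by (simp add: symmetry_copy conj_star_def)
  finally show ?thesis .
qed

lemma mirror_eq:
  assumes "p \<in> hom M W X" "grade M p = 0" "star_preserving M p"
    and "q \<in> hom M W Y" "grade M q = 0" "star_preserving M q"
    and "h \<in> hom M X Z" "grade M h = 0" "k \<in> hom M X Z'" "grade M k = 0"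
    and "h' \<in> hom M Y Z" "grade M h' = 0" "k' \<in> hom M Y Z'" "grade M k' = 0"
    and eq: "(h \<otimes> k) \<cdot> \<Delta> X \<cdot> p = (h' \<otimes> k') \<cdot> \<Delta> Y \<cdot> q"
  shows "(conj_star k \<otimes> conj_star h) \<cdot> \<Delta> X \<cdot> p = (conj_star k' \<otimes> conj_star h') \<cdot> \<Delta> Y \<cdot> q"
proof -
  have "(conj_star k \<otimes> conj_star h) \<cdot> \<Delta> X \<cdot> p \<cdot> \<star> W
      = (conj_star k' \<otimes> conj_star h') \<cdot> \<Delta> Y \<cdot> q \<cdot> \<star> W"
    using mirror [OF assms(1-3,7-10)] mirror [OF assms(4-6,11-14)] eq by simp
  \<comment> \<open>A second star at the source cancels the one produced by
    \<open>mirror\<close>.\<close>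
  then have "((conj_star k \<otimes> conj_star h) \<cdot> \<Delta> X \<cdot> p \<cdot> \<star> W) \<cdot> \<star> W
      = ((conj_star k' \<otimes> conj_star h') \<cdot> \<Delta> Y \<cdot> q \<cdot> \<star> W) \<cdot> \<star> W"
    by simp
  moreover have "X \<in> Obj M" "Y \<in> Obj M" "W \<in> Obj M"
    using assms(1,4) by (auto simp: hom_iff)
  ultimately show ?thesis
    using assms by (simp add: hom_iff)
qed

end

section \<open>Marginals: discarding the right-hand factor\<close>

context quantum_markov_category
begin

text \<open>In a Markov category discarding absorbs the even morphism \<open>k\<close>, and the
  counit law then removes the copy.\<close>

lemma left_marginal:
  assumes "p \<in> hom M W X" "grade M p = 0" "h \<in> hom M X Z" "grade M h = 0"
    and "k \<in> hom M X Z'" "grade M k = 0"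
  shows "right_unitor M Z \<cdot> (\<one> Z \<otimes> \<top> Z') \<cdot> (h \<otimes> k) \<cdot> \<Delta> X \<cdot> p = h \<cdot> p"
proof -
  have t: "p \<in> Mor M" "src M p = W" "tgt M p = X" "h \<in> Mor M" "src M h = X" "tgt M h = Z"
    "k \<in> Mor M" "src M k = X" "tgt M k = Z'"
    using assms by (auto simp: hom_iff)
  then have obj: "X \<in> Obj M" "Z \<in> Obj M" "Z' \<in> Obj M" "W \<in> Obj M"
    by auto
  note simps = t obj assms(2,4,6)
  have "right_unitor M Z \<cdot> (\<one> Z \<otimes> \<top> Z') \<cdot> (h \<otimes> k) \<cdot> \<Delta> X \<cdot> p
      = right_unitor M Z \<cdot> (h \<otimes> \<top> X) \<cdot> \<Delta> X \<cdot> p"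
    using simps discard_even_mor [OF assms(5,6)] by simp
  \<comment> \<open>Splitting off \<open>h\<close> lets it slide through the unitor and exposes the
    counit law.\<close>
  also have "\<dots> = (right_unitor M Z \<cdot> (h \<otimes> \<one> \<I>)) \<cdot> (\<one> X \<otimes> \<top> X) \<cdot> \<Delta> X \<cdot> p"
    using simps by simp
  also have "\<dots> = h \<cdot> (right_unitor M X \<cdot> (\<one> X \<otimes> \<top> X) \<cdot> \<Delta> X) \<cdot> p"
    using simps by (subst right_unitor_natural [OF assms(3,4)]) simp
  also have "\<dots> = h \<cdot> p"
    using simps by (subst counit_right) simp_all
  finally show ?thesis .
qed

lemma left_marginal_eq:
  assumes "p \<in> hom M W X" "grade M p = 0" "q \<in> hom M W Y" "grade M q = 0"
    and "h \<in> hom M X Z" "grade M h = 0" "k \<in> hom M X Z'" "grade M k = 0"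
    and "h' \<in> hom M Y Z" "grade M h' = 0" "k' \<in> hom M Y Z'" "grade M k' = 0"
    and "(h \<otimes> k) \<cdot> \<Delta> X \<cdot> p = (h' \<otimes> k') \<cdot> \<Delta> Y \<cdot> q"
  shows "h \<cdot> p = h' \<cdot> q"
  using left_marginal [OF assms(1,2,5-8)] left_marginal [OF assms(3,4,9-12)] assms(13) by simp

end

section \<open>Bayesian inverses in an even star-preserving subcategory\<close>

locale star_preserving_pair = quantum_markov_category M
  for M :: "('o, 'm, 'e) quantum_cd_scheme" (structure) +
  fixes A :: "'o set" and C :: "'m set" and \<Theta> X Y :: 'o and p f q :: 'm
  assumes sub: "subcategory M A C" and even_C: "even_mors M C"
    and star_C: "star_preserving_mors M C"
    and p_C: "p \<in> C" and p_hom: "p \<in> hom M \<Theta> X"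
    and f_C: "f \<in> C" and f_hom: "f \<in> hom M X Y"
    and q_eq: "q = f \<cdot> p"
begin

lemma even [simp]: "h \<in> C \<Longrightarrow> grade M h = 0"
  and star_pres [simp]: "h \<in> C \<Longrightarrow> star_preserving M h"
  and mor [simp]: "h \<in> C \<Longrightarrow> h \<in> Mor M"
  using sub even_C star_C
  by (auto simp: subcategory_def even_mors_def star_preserving_mors_def)

lemma type [simp]: "p \<in> C" "f \<in> C" "src M p = \<Theta>" "tgt M p = X" "src M f = X" "tgt M f = Y"
  using p_C f_C p_hom f_hom by (auto simp: hom_iff)

lemma obj [simp]: "\<Theta> \<in> Obj M" "X \<in> Obj M" "Y \<in> Obj M"
  using src_tgt_Obj [of p] src_tgt_Obj [of f] by simp_all

lemma q_C [simp]: "q \<in> C"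
  using sub p_C f_C by (simp add: subcategory_def q_eq)

lemma q_type [simp]: "src M q = \<Theta>" "tgt M q = Y"
  by (simp_all add: q_eq)

text \<open>Take the left marginal of the Bayes equation: the factors that remain are
  \<open>g\<close> and an identity.\<close>

lemma bayesian_inverse_comp:
  assumes "bayesian_inverse M C f p q g"
  shows "g \<cdot> q = p"
proof -
  have g: "g \<in> C" "g \<in> hom M Y X" "(g \<otimes> \<one> Y) \<cdot> \<Delta> Y \<cdot> q = (\<one> X \<otimes> f) \<cdot> \<Delta> X \<cdot> p"
    using assms by (simp_all add: bayesian_inverse_def)
  have "g \<cdot> q = \<one> X \<cdot> p"
    by (rule left_marginal_eq [OF _ _ _ _ _ _ _ _ _ _ _ _ g(3)]) (use g in \<open>auto simp: hom_iff\<close>)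
  then show ?thesis by simp
qed

lemma bayesian_inverse_imp_disintegration:
  assumes "bayesian_inverse M C f p q g" and det: "ae_deterministic M p f"
  shows "disintegration M C f p q g"
proof -
  have g: "g \<in> C" "g \<in> hom M Y X" "(g \<otimes> \<one> Y) \<cdot> \<Delta> Y \<cdot> q = (\<one> X \<otimes> f) \<cdot> \<Delta> X \<cdot> p"
    using assms by (simp_all add: bayesian_inverse_def)
  have gt: "src M g = Y" "tgt M g = X"
    using g by (auto simp: hom_iff)
  \<comment> \<open>Merging the two tensor layers gives each side the shape
    \<open>(h \<otimes> k) \<cdot> \<Delta> X \<cdot> p\<close> required for taking
    marginals.\<close>
  have "(((f \<otimes> f) \<cdot> \<Delta> X) \<otimes> \<one> X) \<cdot> \<Delta> X \<cdot> p = ((\<Delta> Y \<cdot> f) \<otimes> \<one> X) \<cdot> \<Delta> X \<cdot> p"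
    using det by (simp add: ae_deterministic_def)
  then have "((f \<otimes> f) \<cdot> \<Delta> X) \<cdot> p = (\<Delta> Y \<cdot> f) \<cdot> p"
    by (rule left_marginal_eq [rotated 12]) (auto simp: hom_iff)
  then have ff: "(f \<otimes> f) \<cdot> \<Delta> X \<cdot> p = \<Delta> Y \<cdot> q"
    by (simp add: q_eq)
  \<comment> \<open>Separating \<open>f\<close> from \<open>g\<close> exposes the left-hand side of
    the Bayes equation.\<close>
  have "((f \<cdot> g) \<otimes> \<one> Y) \<cdot> \<Delta> Y \<cdot> q = (f \<otimes> \<one> Y) \<cdot> (g \<otimes> \<one> Y) \<cdot> \<Delta> Y \<cdot> q"
    using g(1) gt by simp
  also have "\<dots> = (f \<otimes> f) \<cdot> \<Delta> X \<cdot> p"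
    using g by simp
  finally have "ae_equiv M q (f \<cdot> g) (\<one> Y)"
    by (simp add: ae_equiv_def ff)
  then show ?thesis
    using g bayesian_inverse_comp [OF assms(1)] by (simp add: disintegration_def)
qed

lemma bayesian_inverse_ae_unique:
  assumes "bayesian_inverse M C f p q g" "bayesian_inverse M C f p q g'"
  shows "ae_equiv M q g g'"
  using assms by (simp add: bayesian_inverse_def ae_equiv_def)

section \<open>Consequences of a.e. modularity for a fixed disintegration\<close>

context
  fixes g
  assumes modular: "ae_modular M C" and dis: "disintegration M C f p q g"
begin

lemma g_C [simp]: "g \<in> C"
  and g_hom: "g \<in> hom M Y X"
  and g_type [simp]: "src M g = Y" "tgt M g = X"
  and g_q: "g \<cdot> q = p"
  using dis by (auto simp: disintegration_def hom_iff)

text \<open>The premise of modularity is exactly the a.e. equivalence of \<open>f \<cdot> g\<close>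
  with the identity. The layers are merged so that the marginal and mirror lemmas apply.\<close>

lemma disintegration_modular:
  "(((\<one> X \<otimes> f) \<cdot> \<Delta> X \<cdot> g) \<otimes> \<one> Y) \<cdot> \<Delta> Y \<cdot> q = (((g \<otimes> \<one> Y) \<cdot> \<Delta> Y) \<otimes> \<one> Y) \<cdot> \<Delta> Y \<cdot> q"
proof -
  have "((f \<cdot> g) \<otimes> \<one> Y) \<cdot> \<Delta> Y \<cdot> q = \<Delta> Y \<cdot> q"
    using dis by (simp add: disintegration_def ae_equiv_def)
  moreover have "q \<in> hom M \<Theta> Y"
    by (simp add: hom_iff)
  ultimately have "((\<one> X \<otimes> f) \<otimes> \<one> Y) \<cdot> ((\<Delta> X \<cdot> g) \<otimes> \<one> Y) \<cdot> \<Delta> Y \<cdot> q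
      = ((g \<otimes> \<one> Y) \<otimes> \<one> Y) \<cdot> (\<Delta> Y \<otimes> \<one> Y) \<cdot> \<Delta> Y \<cdot> q"
    using modular f_C g_C q_C f_hom g_hom unfolding ae_modular_def by blast
  then show ?thesis
    by simp
qed

lemma disintegration_bayes: "(g \<otimes> \<one> Y) \<cdot> \<Delta> Y \<cdot> q = (\<one> X \<otimes> f) \<cdot> \<Delta> X \<cdot> p"
proof -
  have "((\<one> X \<otimes> f) \<cdot> \<Delta> X \<cdot> g) \<cdot> q = ((g \<otimes> \<one> Y) \<cdot> \<Delta> Y) \<cdot> q"
    using disintegration_modular by (rule left_marginal_eq [rotated 12]) (auto simp: hom_iff)
  then show ?thesis
    by (simp add: g_q)
qed

lemma disintegration_imp_bayesian_inverse: "bayesian_inverse M C f p q g"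
  using disintegration_bayes g_hom by (simp add: bayesian_inverse_def)

text \<open>Here \<open>f\<close>, \<open>g\<close> and the identities are star-preserving, so
  mirroring merely exchanges the factors.\<close>

lemma disintegration_bayes_mirror: "(f \<otimes> \<one> X) \<cdot> \<Delta> X \<cdot> p = (\<one> Y \<otimes> g) \<cdot> \<Delta> Y \<cdot> q"
  using mirror_eq [OF _ _ _ _ _ _ _ _ _ _ _ _ _ _ disintegration_bayes, of \<Theta> X Y]
  by (simp add: hom_iff)

text \<open>Mirroring exchanges only the outer two factors and conjugates the inner composite by
  stars. A further symmetry inside the second factor reverses the inner pair as well, and
  \<open>mirror\<close> evaluates the result.\<close>

lemma disintegration_modular_mirror:
  "(\<one> Y \<otimes> ((f \<otimes> \<one> X) \<cdot> \<Delta> X \<cdot> g)) \<cdot> \<Delta> Y \<cdot> q = (\<one> Y \<otimes> ((\<one> Y \<otimes> g) \<cdot> \<Delta> Y)) \<cdot> \<Delta> Y \<cdot> q"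
proof -
  \<comment> \<open>The trailing \<open>\<one> Y\<close> plays the part of \<open>q\<close> in
    \<open>mirror\<close>.\<close>
  let ?u = "(\<one> X \<otimes> f) \<cdot> \<Delta> X \<cdot> g" and ?v = "(g \<otimes> \<one> Y) \<cdot> \<Delta> Y \<cdot> \<one> Y"
  have u: "\<c> X Y \<cdot> conj_star ?u = (f \<otimes> \<one> X) \<cdot> \<Delta> X \<cdot> g"
  proof -
    have "\<c> X Y \<cdot> conj_star ?u = (\<c> X Y \<cdot> \<star> (X \<odot> Y) \<cdot> ?u) \<cdot> \<star> Y"
      by (simp add: conj_star_def)
    also have "\<dots> = ((f \<otimes> \<one> X) \<cdot> \<Delta> X \<cdot> g \<cdot> \<star> Y) \<cdot> \<star> Y"
      by (subst mirror) (auto simp: hom_iff)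
    finally show ?thesis by simp
  qed
  have v: "\<c> X Y \<cdot> conj_star ?v = (\<one> Y \<otimes> g) \<cdot> \<Delta> Y"
  proof -
    have "\<c> X Y \<cdot> conj_star ?v = (\<c> X Y \<cdot> \<star> (X \<odot> Y) \<cdot> ?v) \<cdot> \<star> Y"
      by (simp add: conj_star_def)
    also have "\<dots> = ((\<one> Y \<otimes> g) \<cdot> \<Delta> Y \<cdot> \<one> Y \<cdot> \<star> Y) \<cdot> \<star> Y"
      by (subst mirror) (auto simp: hom_iff)
    finally show ?thesis by simp
  qed
  have "(?u \<otimes> \<one> Y) \<cdot> \<Delta> Y \<cdot> q = (?v \<otimes> \<one> Y) \<cdot> \<Delta> Y \<cdot> q"
    using disintegration_modular by simp
  then have "(conj_star (\<one> Y) \<otimes> conj_star ?u) \<cdot> \<Delta> Y \<cdot> q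
      = (conj_star (\<one> Y) \<otimes> conj_star ?v) \<cdot> \<Delta> Y \<cdot> q"
    by (rule mirror_eq [rotated 14]) (auto simp: hom_iff)
  then have "(\<one> Y \<otimes> \<c> X Y) \<cdot> (\<one> Y \<otimes> conj_star ?u) \<cdot> \<Delta> Y \<cdot> q
      = (\<one> Y \<otimes> \<c> X Y) \<cdot> (\<one> Y \<otimes> conj_star ?v) \<cdot> \<Delta> Y \<cdot> q"
    by simp
  \<comment> \<open>Interchange moves the symmetry into the second factor, where \<open>u\<close>
    and \<open>v\<close> evaluate it.\<close>
  moreover have "(\<one> Y \<otimes> \<c> X Y) \<cdot> (\<one> Y \<otimes> conj_star w) \<cdot> \<Delta> Y \<cdot> q
      = (\<one> Y \<otimes> (\<c> X Y \<cdot> conj_star w)) \<cdot> \<Delta> Y \<cdot> q"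
    if "w \<in> hom M Y (X \<odot> Y)" "grade M w = 0" for w
    using that by (simp add: hom_iff)
  ultimately show ?thesis
    by (simp add: hom_iff u v [simplified])
qed

text \<open>Rebracketing moves the inner copy to the right-hand factor. There the mirrored Bayes
  equation replaces \<open>f\<close> and \<open>p\<close> by \<open>g\<close> and \<open>q\<close>,
  mirrored modularity moves \<open>g\<close> past the copy, and the same steps are then undone;
  finally the associator is cancelled.\<close>

lemma disintegration_imp_ae_deterministic: "ae_deterministic M p f"
proof -
  have "\<a> Y Y X \<cdot> ((f \<otimes> f) \<otimes> \<one> X) \<cdot> (\<Delta> X \<otimes> \<one> X) \<cdot> \<Delta> X \<cdot> p
      = (f \<otimes> (f \<otimes> \<one> X)) \<cdot> (\<one> X \<otimes> \<Delta> X) \<cdot> \<Delta> X \<cdot> p"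
    \<comment> \<open>Merging of tensor layers is switched off because it would hide the
      coassociativity pattern.\<close>
    by (subst associator_slide) (simp_all add: coassoc_slide del: interchange_assoc)
  also have "\<dots> = (\<one> Y \<otimes> ((f \<otimes> \<one> X) \<cdot> \<Delta> X)) \<cdot> (f \<otimes> \<one> X) \<cdot> \<Delta> X \<cdot> p"
    by simp
  also have "\<dots> = (\<one> Y \<otimes> ((f \<otimes> \<one> X) \<cdot> \<Delta> X \<cdot> g)) \<cdot> \<Delta> Y \<cdot> q"
    by (subst disintegration_bayes_mirror) simp
  also have "\<dots> = (\<one> Y \<otimes> (\<one> Y \<otimes> g)) \<cdot> (\<one> Y \<otimes> \<Delta> Y) \<cdot> \<Delta> Y \<cdot> q"
    by (simp add: disintegration_modular_mirror)
  \<comment> \<open>The identity of \<open>Y \<odot> Y\<close> is written as a tensor so that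
    naturality of the associator matches.\<close>
  also have "\<dots> = \<a> Y Y X \<cdot> ((\<one> Y \<otimes> \<one> Y) \<otimes> g) \<cdot> (\<Delta> Y \<otimes> \<one> Y) \<cdot> \<Delta> Y \<cdot> q"
    by (subst associator_slide) (simp_all add: coassoc_slide del: interchange_assoc tenM_ident_simp)
  \<comment> \<open>Both layerings merge to \<open>\<Delta> Y \<otimes> g\<close>.\<close>
  also have "\<dots> = \<a> Y Y X \<cdot> (\<Delta> Y \<otimes> \<one> X) \<cdot> (\<one> Y \<otimes> g) \<cdot> \<Delta> Y \<cdot> q"
    by simp
  also have "\<dots> = \<a> Y Y X \<cdot> ((\<Delta> Y \<cdot> f) \<otimes> \<one> X) \<cdot> \<Delta> X \<cdot> p"
    by (subst disintegration_bayes_mirror [symmetric]) simp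
  finally have "((f \<otimes> f) \<otimes> \<one> X) \<cdot> (\<Delta> X \<otimes> \<one> X) \<cdot> \<Delta> X \<cdot> p = ((\<Delta> Y \<cdot> f) \<otimes> \<one> X) \<cdot> \<Delta> X \<cdot> p"
    by (rule isomorphism_cancel_left [rotated -1]) (simp_all add: associator_iso)
  then show ?thesis
    by (simp add: ae_deterministic_def)
qed

end

end

theorem corollary8p6:
  fixes M :: "('o, 'm, 'e) quantum_cd_scheme"
    and A :: "'o set" and C :: "'m set"
    and \<Theta> X Y :: 'o and p f q :: 'm
  assumes "quantum_markov_category M"
    and "subcategory M A C"
    and "even_mors M C"
    and "star_preserving_mors M C"
    and "ae_modular M C"
    and "p \<in> C" "p \<in> hom M \<Theta> X"
    and "f \<in> C" "f \<in> hom M X Y"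
    and "q = f \<cdot>\<^bsub>M\<^esub> p"
  shows "((\<exists>g. disintegration M C f p q g) \<longleftrightarrow>
          ae_deterministic M p f \<and> (\<exists>g. bayesian_inverse M C f p q g)) \<and>
         ((\<exists>g. disintegration M C f p q g) \<or>
          (ae_deterministic M p f \<and> (\<exists>g. bayesian_inverse M C f p q g)) \<longrightarrow>
          (\<forall>g g'. disintegration M C f p q g \<longrightarrow> bayesian_inverse M C f p q g' \<longrightarrow>
             ae_equiv M q g g')) \<and>
         (\<forall>g g'. disintegration M C f p q g \<longrightarrow> disintegration M C f p q g' \<longrightarrow>
            ae_equiv M q g g')"
proof -
  interpret quantum_markov_category M
    by fact
  interpret star_preserving_pair M A C \<Theta> X Y p f q
    by unfold_locales (fact assms)+
  note bayes = disintegration_imp_bayesian_inverse [OF \<open>ae_modular M C\<close>]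
    and det = disintegration_imp_ae_deterministic [OF \<open>ae_modular M C\<close>]
  show ?thesis
    \<comment> \<open>By \<open>bayes\<close> every disintegration is a Bayesian inverse, so both
      uniqueness claims reduce to that for Bayesian inverses.\<close>
    using bayes det bayesian_inverse_imp_disintegration bayesian_inverse_ae_unique by blast
qed

end
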